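(* Let $\mathbf K$ be a field, let $\{f_1,\ldots,f_s,F_1,\ldots,F_r\}$ be a set of nonzero polynomials of $\mathbf K[t]$, let $\mathbf A=\mathbf K[f_1,\ldots,f_s]$, and let $\mathbf M=F_1\mathbf A+\cdots+F_r\mathbf A$ be the $\mathbf A$-module generated by $F_1,\ldots,F_r$. Assume that $\mathbf K[t]/\mathbf A$ has finite length as an $\mathbf A$-module, that $\{f_1,\ldots,f_s\}$ is a reduced basis of $\mathbf A$, and that $F_1,\ldots,F_r$ are monic. Then the following conditions are equivalent: (1) $\{F_1,\ldots,F_r\}$ is a basis of $\mathbf M$; (2) for all $F\in \mathrm{MinSP}(F_1,\ldots,F_r)$, $\mathrm R_{\mathbf A}(F,\{F_1,\ldots,F_r\})=0$.
   Context: For a nonzero $f=\sum_i c_it^i\in\mathbf K[t]$ of degree $p$, write $\mathrm d(f)=p$, $\mathrm M(f)=c_pt^p$ (leading monomial) and $\mathrm{supp}(f)=\{i\mid c_i\neq 0\}$; $\mathrm{supp}(0)=\emptyset$. Put $\mathrm d(\mathbf A)=\{\mathrm d(f)\mid f\in\mathbf A\setminus\{0\}\}$ and $\mathrm d(\mathbf M)=\{\mathrm d(F)\mid F\in\mathbf M\setminus\{0\}\}$. The finite length assumption implies that $S=\mathrm d(\mathbf A)$ is a numerical semigroup (a submonoid of $\mathbb N$ with finite complement). The set $\{f_1,\ldots,f_s\}$ is a basis of $\mathbf A$ if $\mathrm d(f_1),\ldots,\mathrm d(f_s)$ generate the monoid $\mathrm d(\mathbf A)$; it is a reduced basis if moreover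 every $f_i$ is monic and $\mathrm{supp}(f_i-\mathrm M(f_i))\subseteq\mathbb N\setminus\mathrm d(\mathbf A)$ for all $i$. The set $\{F_1,\ldots,F_r\}$ is a basis of $\mathbf M$ if $\mathrm d(\mathbf M)=\bigcup_{i=1}^r(\mathrm d(F_i)+\mathrm d(\mathbf A))$. Remainders: for every nonzero $F\in\mathbf K[t]$ there exist $g_1,\ldots,g_r\in\mathbf A$ and $R\in\mathbf K[t]$ with $F=\sum_i g_iF_i+R$; $\mathrm d(g_i)+\mathrm d(F_i)\le\mathrm d(F)$ whenever $g_i\ne0$; and, if $R\neq0$, $\mathrm d(R)\le \mathrm d(F)$ and $\mathrm d(R)\in\mathbb N\setminus\bigcup_{i=1}^r(\mathrm d(F_i)+\mathrm d(\mathbf A))$. For each $F\ne 0$ an (arbitrary) such $R$ is chosen and denoted $\mathrm R_{\mathbf A}(F,\{F_1,\ldots,F_r\})$; also $\mathrm R_{\mathbf A}(0,\{F_1,\ldots,F_r\})=0$. Order on $\mathbb Z$: $n_1\le_S n_2$ iff $n_2-n_1\in S$. For $a,b\in\mathbb N$, let $\{c_1,\ldots,c_q\}$ be the set of minimal elements of $(a+S)\cap(b+S)$ with respect to $\le_S$ (a finite set, the minimal generators of this relative ideal), and set $\mathrm R(a,b)=\{(c_k-a,c_k-b)\mid k=1,\ldots,q\}$; its components lie in $S$. Minimal $S$-polynomials: for $n\in S$ let $\mathsf Z(n)=\{(n_1,\ldots,n_s)\in\mathbb N^s\mid n=\sum_{l=1}^s n_l\,\mathrm d(f_l)\}$, let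 $e(n)=(e_1(n),\ldots,e_s(n))$ be its minimum for the lexicographical order on $\mathbb N^s$, and put $f^{e(n)}=\prod_{l=1}^s f_l^{e_l(n)}$, a monic element of $\mathbf A$ of degree $n$. With $a_i=\mathrm d(F_i)$, $\mathrm{MinSP}(F_1,\ldots,F_r)$ is the set of all polynomials $f^{e(s_i)}F_i-f^{e(s_j)}F_j$ with $i,j\in\{1,\ldots,r\}$, $i\neq j$, and $(s_i,s_j)\in\mathrm R(a_i,a_j)$. *)

theory Defs
  imports
    "HOL-Computational_Algebra.Polynomial"
    "HOL-Algebra.AbelCoset"
    "HOL-Algebra.Module"
begin

text \<open>
  The families \<open>f\<^sub>1, \<dots>, f\<^sub>s\<close> and \<open>F\<^sub>1, \<dots>, F\<^sub>r\<close> are lists \<open>fs\<close> and \<open>Fs\<close>, indexed from 0.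
\<close>

section \<open>The algebra and the module generated by polynomials\<close>

definition K_subalgebra :: "'a::field poly set \<Rightarrow> bool" where
  "K_subalgebra B \<longleftrightarrow> (\<forall>c. [:c:] \<in> B) \<and> (\<forall>x\<in>B. \<forall>y\<in>B. x + y \<in> B \<and> x * y \<in> B)"

definition gen_algebra :: "'a::field poly list \<Rightarrow> 'a poly set" where
  "gen_algebra fs = K_subalgebra hull (set fs)"

definition gen_module :: "'a::field poly set \<Rightarrow> 'a poly list \<Rightarrow> 'a poly set" where
  "gen_module A Fs = {\<Sum>i<length Fs. g i * Fs ! i | g. \<forall>i<length Fs. g i \<in> A}"


section \<open>Modules of finite length\<close>

text \<open>
  The components \<open>mult\<close> and \<open>one\<close> of a module record play no role for a module.
\<close>

definition quotient_module :: "('a, 'b) module \<Rightarrow> 'b set \<Rightarrow> ('a, 'b set) module" where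
  "quotient_module M N =
    \<lparr>carrier = a_rcosets\<^bsub>M\<^esub> N, mult = undefined, one = undefined,
     zero = N, add = set_add M,
     smult = (\<lambda>a X. \<Union>x\<in>X. N +>\<^bsub>M\<^esub> (a \<odot>\<^bsub>M\<^esub> x))\<rparr>"

definition finite_length :: "('a, 'c) ring_scheme \<Rightarrow> ('a, 'b) module \<Rightarrow> bool" where
  "finite_length R M \<longleftrightarrow>
    (\<exists>n. \<forall>k N. (\<forall>i\<le>k. submodule (N i) R M) \<and> (\<forall>i<k. N i \<subset> N (Suc i)) \<longrightarrow> k \<le> n)"

definition algebra_ring :: "'a::field poly set \<Rightarrow> 'a poly ring" where
  "algebra_ring A = \<lparr>carrier = A, mult = (*), one = 1, zero = 0, add = (+)\<rparr>"

definition poly_module :: "('a::field poly, 'a poly) module" where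
  "poly_module =
    \<lparr>carrier = UNIV, mult = (*), one = 1, zero = 0, add = (+), smult = (*)\<rparr>"


section \<open>Degrees and bases\<close>

definition degs :: "'a::field poly set \<Rightarrow> nat set" where
  "degs B = degree ` (B - {0})"

definition supp :: "'a::field poly \<Rightarrow> nat set" where
  "supp f = {i. coeff f i \<noteq> 0}"

definition lead_monom :: "'a::field poly \<Rightarrow> 'a poly" where
  "lead_monom f = monom (lead_coeff f) (degree f)"

definition nat_submonoid :: "nat set \<Rightarrow> bool" where
  "nat_submonoid T \<longleftrightarrow> 0 \<in> T \<and> (\<forall>x\<in>T. \<forall>y\<in>T. x + y \<in> T)"

definition algebra_basis :: "'a::field poly list \<Rightarrow> 'a poly set \<Rightarrow> bool" where
  "algebra_basis fs A \<longleftrightarrow> nat_submonoid hull (degree ` set fs) = degs A"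

definition reduced_basis :: "'a::field poly list \<Rightarrow> 'a poly set \<Rightarrow> bool" where
  "reduced_basis fs A \<longleftrightarrow>
    algebra_basis fs A \<and>
    (\<forall>f\<in>set fs. lead_coeff f = 1 \<and> supp (f - lead_monom f) \<subseteq> - degs A)"

definition covered_degs :: "'a::field poly set \<Rightarrow> 'a poly list \<Rightarrow> nat set" where
  "covered_degs A Fs = (\<Union>F\<in>set Fs. (\<lambda>s. degree F + s) ` degs A)"

definition module_basis :: "'a::field poly set \<Rightarrow> 'a poly list \<Rightarrow> bool" where
  "module_basis A Fs \<longleftrightarrow> degs (gen_module A Fs) = covered_degs A Fs"


section \<open>Remainders\<close>

definition is_remainder ::
  "'a::field poly set \<Rightarrow> 'a poly list \<Rightarrow> 'a poly \<Rightarrow> 'a poly \<Rightarrow> bool" where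
  "is_remainder A Fs F R \<longleftrightarrow>
    (\<exists>g. (\<forall>i<length Fs. g i \<in> A) \<and>
         F = (\<Sum>i<length Fs. g i * Fs ! i) + R \<and>
         (\<forall>i<length Fs. g i \<noteq> 0 \<longrightarrow> degree (g i) + degree (Fs ! i) \<le> degree F) \<and>
         (R \<noteq> 0 \<longrightarrow> degree R \<le> degree F \<and> degree R \<notin> covered_degs A Fs))"

text \<open>
  Remainders are not unique; a function \<open>Rem\<close> with the following property is one of the arbitrary
  choices of \<open>F \<mapsto> R\<^sub>A(F, {F\<^sub>1, \<dots>, F\<^sub>r})\<close>.
\<close>

definition remainder_choice ::
  "'a::field poly set \<Rightarrow> 'a poly list \<Rightarrow> ('a poly \<Rightarrow> 'a poly) \<Rightarrow> bool" where
  "remainder_choice A Fs Rem \<longleftrightarrow>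
    Rem 0 = 0 \<and> (\<forall>F. F \<noteq> 0 \<longrightarrow> is_remainder A Fs F (Rem F))"


section \<open>Minimal S-polynomials\<close>

definition le_S :: "nat set \<Rightarrow> int \<Rightarrow> int \<Rightarrow> bool" where
  "le_S S m n \<longleftrightarrow> n - m \<in> int ` S"

definition minimal_elems :: "nat set \<Rightarrow> nat set \<Rightarrow> nat set" where
  "minimal_elems S I = {c \<in> I. \<forall>c'\<in>I. le_S S (int c') (int c) \<longrightarrow> c' = c}"

text \<open>
  The subtractions below are exact, since \<open>c\<close> lies in \<open>a + S\<close> and in \<open>b + S\<close>.
\<close>

definition min_pairs :: "nat set \<Rightarrow> nat \<Rightarrow> nat \<Rightarrow> (nat \<times> nat) set" where
  "min_pairs S a b =
    {(c - a, c - b) | c. c \<in> minimal_elems S ((\<lambda>s. a + s) ` S \<inter> (\<lambda>s. b + s) ` S)}"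

definition factorizations :: "'a::field poly list \<Rightarrow> nat \<Rightarrow> nat list set" where
  "factorizations fs n =
    {e. length e = length fs \<and> n = (\<Sum>l<length fs. e ! l * degree (fs ! l))}"

definition lex_min_factorization :: "'a::field poly list \<Rightarrow> nat \<Rightarrow> nat list" where
  "lex_min_factorization fs n =
    (THE e. e \<in> factorizations fs n \<and>
       (\<forall>e'\<in>factorizations fs n. e' \<noteq> e \<longrightarrow> (e, e') \<in> lex less_than))"

definition monom_of_degree :: "'a::field poly list \<Rightarrow> nat \<Rightarrow> 'a poly" where
  "monom_of_degree fs n = (\<Prod>l<length fs. fs ! l ^ (lex_min_factorization fs n ! l))"

definition MinSP :: "'a::field poly list \<Rightarrow> 'a poly list \<Rightarrow> 'a poly set" where
  "MinSP fs Fs =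
    {monom_of_degree fs u * Fs ! i - monom_of_degree fs v * Fs ! j | i j u v.
       i < length Fs \<and> j < length Fs \<and> i \<noteq> j \<and>
       (u, v) \<in> min_pairs (degs (gen_algebra fs)) (degree (Fs ! i)) (degree (Fs ! j))}"

end

theory Submission
  imports Defs
begin

text \<open>
  The nontrivial direction is Buchberger's argument. Given \<open>H = \<Sum>i. g\<^sub>i F\<^sub>i\<close> whose terms have degree
  at most \<open>\<delta>\<close>, suppose that the terms \<open>i \<noteq> j\<close> both reach \<open>\<delta>\<close>. Then \<open>\<delta> = c + s\<close> with \<open>s \<in> d(A)\<close> and
  \<open>c\<close> minimal in \<open>(a\<^sub>i + S) \<inter> (a\<^sub>j + S)\<close>, and a multiple, of degree \<open>s\<close>, of the corresponding minimal
  \<open>S\<close>-polynomial can be subtracted to cancel the leading term of \<open>g\<^sub>i F\<^sub>i\<close>. As the \<open>S\<close>-polynomial has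
  remainder 0, it is a combination of the \<open>F\<^sub>k\<close> with terms of degree less than \<open>c\<close>, so that fewer
  terms reach \<open>\<delta>\<close>. Once a single term reaches the bound, it determines the degree of \<open>H\<close>.
\<close>

section \<open>The subalgebra and its degrees\<close>

text \<open>Subalgebras are stable under arbitrary intersections, so the hull is itself one.\<close>

lemma K_subalgebra_gen_algebra: "K_subalgebra (gen_algebra fs)"
  unfolding gen_algebra_def by (rule hull_in) (auto simp: K_subalgebra_def)

context
  fixes A :: "'a::field poly set"
  assumes A: "K_subalgebra A"
begin

lemma K_subalgebra_const: "[:c:] \<in> A"
  and K_subalgebra_add: "x \<in> A \<Longrightarrow> y \<in> A \<Longrightarrow> x + y \<in> A"
  and K_subalgebra_mult: "x \<in> A \<Longrightarrow> y \<in> A \<Longrightarrow> x * y \<in> A"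
  using A by (auto simp: K_subalgebra_def)

lemma K_subalgebra_0: "0 \<in> A"
  using K_subalgebra_const[of 0] by simp

lemma K_subalgebra_1: "1 \<in> A"
  using K_subalgebra_const[of 1] by (simp add: one_pCons)

lemma K_subalgebra_smult: "x \<in> A \<Longrightarrow> Polynomial.smult c x \<in> A"
  using K_subalgebra_mult[OF K_subalgebra_const[of c]] by simp

lemma K_subalgebra_diff: "x \<in> A \<Longrightarrow> y \<in> A \<Longrightarrow> x - y \<in> A"
  using K_subalgebra_add[of x "Polynomial.smult (-1) y"] K_subalgebra_smult[of y "-1"] by simp

lemma K_subalgebra_power: "x \<in> A \<Longrightarrow> x ^ n \<in> A"
  by (induction n) (auto intro: K_subalgebra_1 K_subalgebra_mult)

lemma K_subalgebra_prod: "(\<And>i. i \<in> I \<Longrightarrow> h i \<in> A) \<Longrightarrow> prod h I \<in> A"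
  by (induction I rule: infinite_finite_induct) (auto intro: K_subalgebra_1 K_subalgebra_mult)

lemma degs_add:
  assumes "m \<in> degs A" "n \<in> degs A"
  shows "m + n \<in> degs A"
proof -
  obtain x y where "x \<in> A" "x \<noteq> 0" "m = degree x" "y \<in> A" "y \<noteq> 0" "n = degree y"
    using assms unfolding degs_def by blast
  then have "x * y \<in> A - {0}" "degree (x * y) = m + n"
    by (auto simp: K_subalgebra_mult degree_mult_eq)
  then show ?thesis
    unfolding degs_def by (metis imageI)
qed

section \<open>The generated module and its degrees\<close>

lemma gen_module_closed_diff:
  assumes "x \<in> gen_module A Fs" "y \<in> gen_module A Fs"
  shows "x - y \<in> gen_module A Fs"
proof -
  obtain g h where "\<forall>i<length Fs. g i \<in> A" "x = (\<Sum>i<length Fs. g i * Fs ! i)"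
    "\<forall>i<length Fs. h i \<in> A" "y = (\<Sum>i<length Fs. h i * Fs ! i)"
    using assms unfolding gen_module_def by blast
  then have "x - y = (\<Sum>i<length Fs. (g i - h i) * Fs ! i)" "\<forall>i<length Fs. g i - h i \<in> A"
    by (auto simp: sum_subtractf left_diff_distrib K_subalgebra_diff)
  then show ?thesis
    unfolding gen_module_def mem_Collect_eq by (intro exI[of _ "\<lambda>i. g i - h i"] conjI)
qed

lemma gen_module_mult_generator:
  assumes "x \<in> A" "i < length Fs"
  shows "x * Fs ! i \<in> gen_module A Fs"
proof -
  define g where "g k = (if k = i then x else 0)" for k
  have "(\<Sum>k<length Fs. g k * Fs ! k) = (\<Sum>k<length Fs. if k = i then x * Fs ! i else 0)"
    by (rule sum.cong) (auto simp: g_def)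
  also have "\<dots> = x * Fs ! i"
    using assms by simp
  finally have "x * Fs ! i = (\<Sum>k<length Fs. g k * Fs ! k)" ..
  moreover have "\<forall>k<length Fs. g k \<in> A"
    using assms K_subalgebra_0 by (auto simp: g_def)
  ultimately show ?thesis
    unfolding gen_module_def by blast
qed

text \<open>Degrees add in products of nonzero polynomials. This is the easy half of the basis
  property; only the reverse inclusion is at stake later.\<close>

lemma covered_degs_subset_degs_gen_module:
  assumes "\<forall>F\<in>set Fs. F \<noteq> 0"
  shows "covered_degs A Fs \<subseteq> degs (gen_module A Fs)"
proof
  fix n assume "n \<in> covered_degs A Fs"
  then obtain F x where "F \<in> set Fs" and x: "x \<in> A" "x \<noteq> 0" "n = degree F + degree x"
    unfolding covered_degs_def degs_def by blast
  then obtain i where "i < length Fs" "F = Fs ! i"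
    by (auto simp: in_set_conv_nth)
  moreover have "F \<noteq> 0"
    using assms \<open>F \<in> set Fs\<close> by blast
  ultimately have "x * Fs ! i \<in> gen_module A Fs - {0}" "n = degree (x * Fs ! i)"
    using x by (auto simp: gen_module_mult_generator degree_mult_eq)
  then show "n \<in> degs (gen_module A Fs)"
    unfolding degs_def by blast
qed

end

text \<open>\<open>F - R\<close> is a combination of the generators. A nonzero remainder of a module
  element thus has a degree of the module that is not covered, which a basis forbids.\<close>

lemma is_remainder_in_gen_module:
  assumes "K_subalgebra A" "is_remainder A Fs F R" "F \<in> gen_module A Fs"
  shows "R \<in> gen_module A Fs"
proof -
  obtain g where "\<forall>i<length Fs. g i \<in> A" "F = (\<Sum>i<length Fs. g i * Fs ! i) + R"
    using assms(2) unfolding is_remainder_def by blast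
  then have "F - R \<in> gen_module A Fs"
    unfolding gen_module_def by (auto intro!: exI[of _ g])
  from gen_module_closed_diff[OF assms(1,3) this] show ?thesis
    by simp
qed

lemma in_covered_degsI:
  "i < length Fs \<Longrightarrow> x \<in> A \<Longrightarrow> x \<noteq> 0 \<Longrightarrow> degree x + degree (Fs ! i) \<in> covered_degs A Fs"
  unfolding covered_degs_def degs_def by (force simp: add.commute)


section \<open>Monomials in the generators of the algebra\<close>

text \<open>Exponent vectors add componentwise. Stated as a submonoid so that minimality of the hull
  yields factorizations of all its elements.\<close>

lemma nat_submonoid_factorizations: "nat_submonoid {n. factorizations fs n \<noteq> {}}"
proof -
  have "replicate (length fs) 0 \<in> factorizations fs 0"
    by (simp add: factorizations_def)
  moreover have "map2 (+) d e \<in> factorizations fs (m + n)"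
    if "d \<in> factorizations fs m" "e \<in> factorizations fs n" for d e m n
    using that by (auto simp: factorizations_def distrib_right simp flip: sum.distrib)
  ultimately show ?thesis
    unfolding nat_submonoid_def by blast
qed

lemma factorizations_nonempty:
  assumes "n \<in> nat_submonoid hull (degree ` set fs)"
  shows "factorizations fs n \<noteq> {}"
proof -
  have "factorizations fs (degree f) \<noteq> {}" if "f \<in> set fs" for f
  proof -
    obtain i where i: "i < length fs" "f = fs ! i"
      using \<open>f \<in> set fs\<close> by (auto simp: in_set_conv_nth)
    let ?e = "(replicate (length fs) 0)[i := Suc 0]"
    have "(\<Sum>l<length fs. ?e ! l * degree (fs ! l)) =
        (\<Sum>l<length fs. if l = i then degree (fs ! i) else 0)"
      by (rule sum.cong) (auto simp: nth_list_update)
    also have "\<dots> = degree f"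
      using i by simp
    finally have "?e \<in> factorizations fs (degree f)"
      by (simp add: factorizations_def)
    then show ?thesis
      by blast
  qed
  then have "nat_submonoid hull (degree ` set fs) \<subseteq> {n. factorizations fs n \<noteq> {}}"
    by (intro hull_minimal nat_submonoid_factorizations) auto
  with assms show ?thesis
    by blast
qed

text \<open>\<open>lenlex\<close> is total and compares lengths first, so on lists of equal length
  it coincides with \<open>lex\<close>.\<close>

lemma lex_less_than_total:
  assumes "length xs = length ys" "xs \<noteq> ys"
  shows "(xs, ys) \<in> lex less_than \<or> (ys, xs) \<in> lex less_than"
proof -
  have "total (lenlex less_than)"
    by (simp add: total_lenlex)
  then have "(xs, ys) \<in> lenlex less_than \<or> (ys, xs) \<in> lenlex less_than"
    using assms(2) by (simp add: total_on_def)
  then show ?thesis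
    using assms(1) by (simp add: lenlex_conv)
qed

text \<open>Well-foundedness of \<open>lex less_than\<close> gives a minimal factorization, totality
  on equal lengths makes it least, and asymmetry makes it unique, so the description by
  \<open>THE\<close> is proper.\<close>

lemma lex_min_factorization_in_factorizations:
  assumes "factorizations fs n \<noteq> {}"
  shows "lex_min_factorization fs n \<in> factorizations fs n"
proof -
  let ?P = "\<lambda>e. e \<in> factorizations fs n \<and>
    (\<forall>e'\<in>factorizations fs n. e' \<noteq> e \<longrightarrow> (e, e') \<in> lex less_than)"
  have wf: "wf (lex less_than)"
    by (intro wf_lex wf_less_than)
  obtain e where e: "e \<in> factorizations fs n"
    "\<And>e'. (e', e) \<in> lex less_than \<Longrightarrow> e' \<notin> factorizations fs n"
    using assms wfE_min[OF wf] by (metis ex_in_conv)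
  have "(e, e') \<in> lex less_than" if "e' \<in> factorizations fs n" "e' \<noteq> e" for e'
    using lex_less_than_total[of e e'] e that by (auto simp: factorizations_def)
  with e(1) have "?P e"
    by blast
  moreover have "e' = e" if "?P e'" for e'
  proof (rule ccontr)
    assume "e' \<noteq> e"
    then have "(e, e') \<in> lex less_than" "(e', e) \<in> lex less_than"
      using that \<open>?P e\<close> by auto
    then show False
      using wf_asym[OF wf] by blast
  qed
  ultimately have "?P (lex_min_factorization fs n)"
    unfolding lex_min_factorization_def by (rule theI)
  then show ?thesis
    by blast
qed

lemma degree_prod_power_monic:
  fixes p :: "nat \<Rightarrow> 'a::field poly"
  assumes "\<And>l. l \<in> I \<Longrightarrow> lead_coeff (p l) = 1"
  shows "degree (\<Prod>l\<in>I. p l ^ e l) = (\<Sum>l\<in>I. e l * degree (p l))"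
proof -
  have "p l \<noteq> 0" if "l \<in> I" for l
    using assms[OF that] by auto
  then show ?thesis
    by (subst degree_prod_eq_sum_degree) (auto simp: degree_power_eq intro: sum.cong)
qed

lemma monom_of_degree_monic:
  assumes "\<forall>f\<in>set fs. lead_coeff f = 1"
  shows "lead_coeff (monom_of_degree fs n) = 1"
  using assms unfolding monom_of_degree_def
  by (subst lead_coeff_prod) (simp add: lead_coeff_power)

text \<open>The basis property enters here: each degree of \<open>A\<close> is a sum of degrees of
  the generators, so the chosen exponent vector really is a factorization of
  \<open>n\<close>.\<close>

lemma degree_monom_of_degree:
  assumes "reduced_basis fs A" "n \<in> degs A"
  shows "degree (monom_of_degree fs n) = n"
proof -
  have "n \<in> nat_submonoid hull (degree ` set fs)"
    using assms by (simp add: reduced_basis_def algebra_basis_def)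
  then have "lex_min_factorization fs n \<in> factorizations fs n"
    by (intro lex_min_factorization_in_factorizations factorizations_nonempty)
  then show ?thesis
    using assms unfolding monom_of_degree_def
    by (subst degree_prod_power_monic) (auto simp: reduced_basis_def factorizations_def)
qed

lemma monom_of_degree_in_gen_algebra: "monom_of_degree fs n \<in> gen_algebra fs"
proof -
  have "set fs \<subseteq> gen_algebra fs"
    unfolding gen_algebra_def by (rule hull_subset)
  then show ?thesis
    unfolding monom_of_degree_def
    by (intro K_subalgebra_prod K_subalgebra_power K_subalgebra_gen_algebra) auto
qed


section \<open>Minimal \<open>S\<close>-polynomials\<close>

text \<open>Descent: if \<open>n\<close> is not minimal, then \<open>n = m + s\<close> with
  \<open>m\<close> in \<open>I\<close> and \<open>m \<noteq> n\<close>, hence \<open>m < n\<close>;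
  the differences met on the way add up inside \<open>S\<close>.\<close>

lemma minimal_elem_below:
  assumes "\<And>x y. x \<in> S \<Longrightarrow> y \<in> S \<Longrightarrow> x + y \<in> S" "0 \<in> S" "n \<in> I"
  shows "\<exists>c\<in>minimal_elems S I. \<exists>s\<in>S. n = c + s"
  using \<open>n \<in> I\<close>
proof (induction n rule: less_induct)
  case (less n)
  show ?case
  proof (cases "n \<in> minimal_elems S I")
    case True
    then show ?thesis
      using \<open>0 \<in> S\<close> by force
  next
    case False
    then obtain m s where m: "m \<in> I" "m \<noteq> n" "s \<in> S" "n = m + s"
      using less.prems unfolding minimal_elems_def le_S_def
      by (auto simp: algebra_simps simp flip: of_nat_add)
    with less.IH[of m] obtain c t where "c \<in> minimal_elems S I" "t \<in> S" "m = c + t"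
      by auto
    then show ?thesis
      using m assms(1) by (auto simp: add.assoc)
  qed
qed

text \<open>The coefficients at the common degree cancel. Equal constants must be excluded, because
  \<open>degree 0 = 0\<close> is not strictly smaller.\<close>

lemma degree_diff_less_same_lead_coeff:
  fixes p q :: "'a::field poly"
  assumes "lead_coeff p = c" "lead_coeff q = c" "degree p = degree q" "p - q \<noteq> 0"
  shows "degree (p - q) < degree p"
proof -
  have "degree (p - q) \<le> degree p"
    using assms by (intro degree_diff_le) auto
  moreover have "coeff (p - q) (degree p) = 0"
    using assms by simp
  ultimately show ?thesis
    using assms(4) by (metis le_neq_implies_less leading_coeff_0_iff)
qed

text \<open>Bounds are guarded by nonvanishing throughout: a zero coefficient contributes no term,
  although \<open>degree 0 = 0\<close> would charge it with \<open>a\<close>.\<close>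

lemma degree_add_bound:
  fixes p q :: "'a::field poly"
  assumes "p \<noteq> 0 \<longrightarrow> degree p + a \<le> d" "q \<noteq> 0 \<longrightarrow> degree q + a \<le> d" "p + q \<noteq> 0"
  shows "degree (p + q) + a \<le> d"
  using assms degree_add_le_max[of p q] by (cases "p = 0"; cases "q = 0") auto

lemma degree_add_strict_bound:
  fixes p q :: "'a::field poly"
  assumes "p \<noteq> 0 \<longrightarrow> degree p + a < d" "q \<noteq> 0 \<longrightarrow> degree q + a < d" "p + q \<noteq> 0"
  shows "degree (p + q) + a < d"
  using assms degree_add_le_max[of p q] by (cases "p = 0"; cases "q = 0") auto

lemma MinSP_subset_gen_module: "MinSP fs Fs \<subseteq> gen_module (gen_algebra fs) Fs"
  unfolding MinSP_def
  by (auto intro!: gen_module_closed_diff gen_module_mult_generator K_subalgebra_gen_algebra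
      monom_of_degree_in_gen_algebra)

text \<open>Both products have degree \<open>c\<close> and leading coefficient 1, so their
  difference has degree below \<open>c\<close>. Remainder 0 then writes it with terms no larger than
  that degree.\<close>

lemma MinSP_representation:
  assumes "reduced_basis fs (gen_algebra fs)" "\<forall>F\<in>set Fs. lead_coeff F = 1"
    and "\<forall>F\<in>MinSP fs Fs. F \<noteq> 0 \<longrightarrow> is_remainder (gen_algebra fs) Fs F 0"
    and "i < length Fs" "j < length Fs" "i \<noteq> j"
    and "u \<in> degs (gen_algebra fs)" "v \<in> degs (gen_algebra fs)"
    and "c = u + degree (Fs ! i)" "c = v + degree (Fs ! j)"
    and "(u, v) \<in> min_pairs (degs (gen_algebra fs)) (degree (Fs ! i)) (degree (Fs ! j))"
  obtains h where "\<forall>k<length Fs. h k \<in> gen_algebra fs"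
    and "monom_of_degree fs u * Fs ! i - monom_of_degree fs v * Fs ! j =
      (\<Sum>k<length Fs. h k * Fs ! k)"
    and "\<forall>k<length Fs. h k \<noteq> 0 \<longrightarrow> degree (h k) + degree (Fs ! k) < c"
proof -
  let ?p = "monom_of_degree fs u * Fs ! i" and ?q = "monom_of_degree fs v * Fs ! j"
  have monic: "lead_coeff (monom_of_degree fs n) = 1" for n
    using assms(1) by (intro monom_of_degree_monic) (simp add: reduced_basis_def)
  have nonzero: "monom_of_degree fs n \<noteq> 0" for n
    using monic[of n] by auto
  have Fs: "lead_coeff (Fs ! i) = 1" "lead_coeff (Fs ! j) = 1"
    using assms by auto
  then have Fs_nonzero: "Fs ! i \<noteq> 0" "Fs ! j \<noteq> 0"
    by auto
  show thesis
  \<comment> \<open>The remainder hypothesis speaks of nonzero polynomials only; a vanishing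
    difference is represented by zero coefficients.\<close>
  proof (cases "?p - ?q = 0")
    case True
    then show thesis
      using that[of "\<lambda>_. 0"] by (simp add: K_subalgebra_0 K_subalgebra_gen_algebra)
  next
    case False
    have deg: "degree ?p = c" "degree ?q = c"
      using assms nonzero Fs_nonzero by (simp_all add: degree_mult_eq degree_monom_of_degree)
    have "lead_coeff ?p = 1" "lead_coeff ?q = 1"
      by (simp_all add: lead_coeff_mult monic Fs)
    then have less: "degree (?p - ?q) < c"
      using degree_diff_less_same_lead_coeff[of ?p 1 ?q] deg False by simp
    have "?p - ?q \<in> MinSP fs Fs"
      unfolding MinSP_def using assms by blast
    with False assms(3) have "is_remainder (gen_algebra fs) Fs (?p - ?q) 0"
      by blast
    then show thesis
      unfolding is_remainder_def using that less by (metis (no_types, lifting) add_0_right le_less_trans)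
  qed
qed

section \<open>Cancellation of top terms and descent\<close>

definition top_terms :: "'a::field poly list \<Rightarrow> (nat \<Rightarrow> 'a poly) \<Rightarrow> nat \<Rightarrow> nat set" where
  "top_terms Fs g \<delta> = {k. k < length Fs \<and> g k \<noteq> 0 \<and> degree (g k) + degree (Fs ! k) = \<delta>}"

lemma finite_top_terms: "finite (top_terms Fs g \<delta>)"
  by (simp add: top_terms_def)

text \<open>The represented element stays the same and only its coefficients change. The index
  \<open>i\<close> leaves the set of top terms, \<open>j\<close> may stay, and no new index
  enters.\<close>

lemma cancel_top_term:
  assumes reduced: "reduced_basis fs (gen_algebra fs)"
    and monic: "\<forall>F\<in>set Fs. lead_coeff F = 1"
    and rem: "\<forall>F\<in>MinSP fs Fs. F \<noteq> 0 \<longrightarrow> is_remainder (gen_algebra fs) Fs F 0"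
    and g: "\<forall>k<length Fs. g k \<in> gen_algebra fs"
    and bound: "\<forall>k<length Fs. g k \<noteq> 0 \<longrightarrow> degree (g k) + degree (Fs ! k) \<le> \<delta>"
    and i: "i \<in> top_terms Fs g \<delta>" and j: "j \<in> top_terms Fs g \<delta>" and "i \<noteq> j"
  obtains g' where "\<forall>k<length Fs. g' k \<in> gen_algebra fs"
    and "\<forall>k<length Fs. g' k \<noteq> 0 \<longrightarrow> degree (g' k) + degree (Fs ! k) \<le> \<delta>"
    and "(\<Sum>k<length Fs. g' k * Fs ! k) = (\<Sum>k<length Fs. g k * Fs ! k)"
    and "top_terms Fs g' \<delta> \<subset> top_terms Fs g \<delta>"
proof -
  let ?A = "gen_algebra fs" and ?n = "length Fs"
  let ?S = "degs ?A"
  let ?a = "degree (Fs ! i)" and ?b = "degree (Fs ! j)"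
  let ?I = "(\<lambda>s. ?a + s) ` ?S \<inter> (\<lambda>s. ?b + s) ` ?S"
  note A = K_subalgebra_gen_algebra[of fs]
  have ij: "i < ?n" "g i \<noteq> 0" "degree (g i) + ?a = \<delta>" "j < ?n" "g j \<noteq> 0" "degree (g j) + ?b = \<delta>"
    using i j by (auto simp: top_terms_def)
  have "degree (g i) \<in> ?S" "degree (g j) \<in> ?S"
    using g ij unfolding degs_def by auto
  moreover have "\<delta> = ?a + degree (g i)" "\<delta> = ?b + degree (g j)"
    using ij by auto
  ultimately have "\<delta> \<in> ?I"
    by blast
  moreover have "0 \<in> ?S"
    unfolding degs_def using K_subalgebra_1[OF A] by force
  ultimately obtain c s where c: "c \<in> minimal_elems ?S ?I" and s: "s \<in> ?S" "\<delta> = c + s"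
    using minimal_elem_below[of ?S \<delta> ?I] degs_add[OF A] by blast
  then obtain u v where uv: "u \<in> ?S" "c = u + ?a" "v \<in> ?S" "c = v + ?b"
    unfolding minimal_elems_def by (auto simp: add.commute)
  have "(u, v) \<in> min_pairs ?S ?a ?b"
    unfolding min_pairs_def using c uv by force
  then obtain h where h: "\<forall>k<?n. h k \<in> ?A"
    and P: "monom_of_degree fs u * Fs ! i - monom_of_degree fs v * Fs ! j = (\<Sum>k<?n. h k * Fs ! k)"
    and h_bound: "\<forall>k<?n. h k \<noteq> 0 \<longrightarrow> degree (h k) + degree (Fs ! k) < c"
    using MinSP_representation[OF reduced monic rem ij(1,4) \<open>i \<noteq> j\<close> uv(1,3,2,4)] by blast
  have lc: "lead_coeff (monom_of_degree fs n) = 1" for n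
    using reduced by (intro monom_of_degree_monic) (simp add: reduced_basis_def)
  then have mon_nonzero: "monom_of_degree fs n \<noteq> 0" for n
    by (metis leading_coeff_0_iff zero_neq_one)
  note deg_mon = degree_monom_of_degree[OF reduced]
  have lc_s: "coeff (monom_of_degree fs s) s = 1"
    using lc[of s] s by (simp add: deg_mon)
  \<comment> \<open>The degree \<open>s = \<delta> - c\<close> and the scalar are chosen so that
    \<open>m * monom_of_degree fs u\<close> has the degree and the leading coefficient of
    \<open>g i\<close>.\<close>
  define m where "m = Polynomial.smult (lead_coeff (g i)) (monom_of_degree fs s)"
  have m: "m \<in> ?A" "m \<noteq> 0" "degree m = s" "lead_coeff m = lead_coeff (g i)"
    using ij s by (simp_all add: m_def lc_s mon_nonzero deg_mon monom_of_degree_in_gen_algebra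
        K_subalgebra_smult[OF A] lead_coeff_smult)
  define mu where "mu = m * monom_of_degree fs u"
  define mv where "mv = m * monom_of_degree fs v"
  have mu: "mu \<in> ?A" "mu \<noteq> 0" "degree mu = s + u"
    using m uv by (simp_all add: mu_def mon_nonzero degree_mult_eq deg_mon
        K_subalgebra_mult[OF A] monom_of_degree_in_gen_algebra)
  have lc_mu: "lead_coeff mu = lead_coeff (g i)"
    unfolding mu_def lead_coeff_mult lc m(4) by simp
  have mv: "mv \<in> ?A" "mv \<noteq> 0" "degree mv = s + v"
    using m uv by (simp_all add: mv_def mon_nonzero degree_mult_eq deg_mon
        K_subalgebra_mult[OF A] monom_of_degree_in_gen_algebra)
  \<comment> \<open>This subtracts from \<open>g\<close> the coefficients of a relation:
    \<open>m\<close> times the difference between the S-polynomial and its representation by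
    \<open>h\<close>.\<close>
  define g' where "g' k = g k + (if k = i then - mu else 0) + (if k = j then mv else 0) + m * h k" for k
  \<comment> \<open>Multiplication by \<open>m\<close> shifts the strict bound \<open>c\<close> of
    \<open>h\<close> to \<open>c + s = \<delta>\<close>.\<close>
  have mh_bound: "m * h k \<noteq> 0 \<longrightarrow> degree (m * h k) + degree (Fs ! k) < \<delta>" if "k < ?n" for k
    using h_bound that m s by (auto simp: degree_mult_eq)
  have g'_other: "g' k = g k + m * h k" if "k \<noteq> i" "k \<noteq> j" for k
    using that by (simp add: g'_def)
  have "degree (g i) = degree mu"
    using mu ij s uv by simp
  then have gi: "g i - mu \<noteq> 0 \<longrightarrow> degree (g i - mu) + ?a < \<delta>"
    using degree_diff_less_same_lead_coeff[OF refl lc_mu] ij(3) by auto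
  have g'_i: "g' i \<noteq> 0 \<longrightarrow> degree (g' i) + ?a < \<delta>"
    using degree_add_strict_bound[OF gi mh_bound[OF ij(1)]] \<open>i \<noteq> j\<close> by (simp add: g'_def)
  \<comment> \<open>At \<open>j\<close> both summands reach \<open>\<delta>\<close>, so only a weak
    bound is available; \<open>j\<close> was a top term already.\<close>
  have "g j + mv \<noteq> 0 \<longrightarrow> degree (g j + mv) + ?b \<le> \<delta>"
    using degree_add_bound[of "g j" ?b \<delta> mv] ij mv s uv by auto
  moreover have "m * h j \<noteq> 0 \<longrightarrow> degree (m * h j) + ?b \<le> \<delta>"
    using mh_bound[OF ij(4)] by auto
  ultimately have g'_j: "g' j \<noteq> 0 \<longrightarrow> degree (g' j) + ?b \<le> \<delta>"
    using degree_add_bound[of "g j + mv" ?b \<delta> "m * h j"] \<open>i \<noteq> j\<close> by (simp add: g'_def)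
  show thesis
  proof (rule that[of g'])
    show "\<forall>k<?n. g' k \<in> ?A"
      using g h m mu mv
      by (auto simp: g'_def
          intro!: K_subalgebra_add[OF A] K_subalgebra_diff[OF A] K_subalgebra_mult[OF A])
    show "\<forall>k<?n. g' k \<noteq> 0 \<longrightarrow> degree (g' k) + degree (Fs ! k) \<le> \<delta>"
    proof (intro allI impI)
      fix k assume k: "k < ?n" "g' k \<noteq> 0"
      consider "k = i" | "k = j" | "k \<noteq> i" "k \<noteq> j"
        by blast
      then show "degree (g' k) + degree (Fs ! k) \<le> \<delta>"
      proof cases
        case 3
        then show ?thesis
          using degree_add_bound[of "g k" "degree (Fs ! k)" \<delta> "m * h k"] k g'_other[of k]
            bound mh_bound[of k] by (auto simp: less_imp_le)
      qed (use k g'_i g'_j in auto)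
    qed
    have "(\<Sum>k<?n. g' k * Fs ! k) =
        (\<Sum>k<?n. g k * Fs ! k + (if k = i then - mu * Fs ! i else 0) +
          (if k = j then mv * Fs ! j else 0) + m * (h k * Fs ! k))"
      by (rule sum.cong) (auto simp: g'_def algebra_simps)
    also have "\<dots> = (\<Sum>k<?n. g k * Fs ! k) - mu * Fs ! i + mv * Fs ! j + m * (\<Sum>k<?n. h k * Fs ! k)"
      using ij by (simp add: sum.distrib sum_distrib_left)
    also have "\<dots> = (\<Sum>k<?n. g k * Fs ! k)"
      by (simp add: mu_def mv_def algebra_simps flip: P)
    finally show "(\<Sum>k<?n. g' k * Fs ! k) = (\<Sum>k<?n. g k * Fs ! k)" .
    \<comment> \<open>Away from \<open>i\<close> and \<open>j\<close> only \<open>m * h k\<close> is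
      added, which stays strictly below the bound and so cannot create a top term.\<close>
    have "k \<in> top_terms Fs g \<delta>" if k: "k \<in> top_terms Fs g' \<delta>" "k \<noteq> i" "k \<noteq> j" for k
    proof (rule ccontr)
      assume "k \<notin> top_terms Fs g \<delta>"
      moreover have k': "k < ?n" "g' k \<noteq> 0" "degree (g' k) + degree (Fs ! k) = \<delta>"
        using k by (auto simp: top_terms_def)
      ultimately have "g k \<noteq> 0 \<longrightarrow> degree (g k) + degree (Fs ! k) < \<delta>"
        using bound by (auto simp: top_terms_def order_less_le)
      then show False
        using degree_add_strict_bound[OF _ mh_bound[OF k'(1)]] k' g'_other[OF k(2,3)] by fastforce
    qed
    moreover have "i \<notin> top_terms Fs g' \<delta>"
      using g'_i by (auto simp: top_terms_def)
    ultimately show "top_terms Fs g' \<delta> \<subset> top_terms Fs g \<delta>"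
      using i j by blast
  qed
qed

text \<open>Only the term \<open>i\<close> contributes to the coefficient at
  \<open>\<delta>\<close>, so nothing cancels there and the sum has degree
  \<open>\<delta>\<close>.\<close>

lemma degree_in_covered_degs_if_single_top_term:
  fixes Fs :: "'a::field poly list"
  assumes "\<forall>F\<in>set Fs. lead_coeff F = 1" "\<forall>k<length Fs. g k \<in> A"
    and bound: "\<forall>k<length Fs. g k \<noteq> 0 \<longrightarrow> degree (g k) + degree (Fs ! k) \<le> \<delta>"
    and single: "top_terms Fs g \<delta> = {i}"
  shows "degree (\<Sum>k<length Fs. g k * Fs ! k) \<in> covered_degs A Fs"
proof -
  let ?H = "\<Sum>k<length Fs. g k * Fs ! k"
  have i: "i < length Fs" "g i \<noteq> 0" "degree (g i) + degree (Fs ! i) = \<delta>"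
    using single by (auto simp: top_terms_def)
  have nz: "Fs ! k \<noteq> 0" if "k < length Fs" for k
    using assms(1) that by (metis leading_coeff_0_iff nth_mem zero_neq_one)
  have deg: "degree (g k * Fs ! k) \<le> \<delta>" if "k < length Fs" for k
    using bound nz that by (cases "g k = 0") (auto simp: degree_mult_eq)
  have "coeff (g k * Fs ! k) \<delta> = 0" if "k < length Fs" "k \<noteq> i" for k
  proof (cases "g k = 0")
    case False
    have "k \<notin> top_terms Fs g \<delta>"
      using single that by blast
    then have "degree (g k * Fs ! k) < \<delta>"
      using that False bound nz by (auto simp: top_terms_def degree_mult_eq order_less_le)
    then show ?thesis
      by (rule coeff_eq_0)
  qed simp
  then have "coeff ?H \<delta> = (\<Sum>k<length Fs. if k = i then coeff (g i * Fs ! i) \<delta> else 0)"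
    unfolding coeff_sum by (intro sum.cong) auto
  also have "\<dots> = lead_coeff (g i * Fs ! i)"
    using i nz[of i] by (simp add: degree_mult_eq)
  finally have "coeff ?H \<delta> \<noteq> 0"
    using i nz[of i] by simp
  moreover have "degree ?H \<le> \<delta>"
    using deg by (intro degree_sum_le) auto
  ultimately have "degree ?H = \<delta>"
    by (simp add: le_antisym le_degree)
  with i assms(2) show ?thesis
    using in_covered_degsI by metis
qed

text \<open>Lexicographic induction on the bound and then on the number of top terms: with no top
  term the bound drops, with one the degree is known, and with two or more a cancellation lowers
  their number at the same bound.\<close>

lemma degree_in_covered_degs:
  fixes Fs :: "'a::field poly list"
  assumes "reduced_basis fs (gen_algebra fs)" "\<forall>F\<in>set Fs. lead_coeff F = 1"
    and "\<forall>F\<in>MinSP fs Fs. F \<noteq> 0 \<longrightarrow> is_remainder (gen_algebra fs) Fs F 0"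
    and "\<forall>k<length Fs. g k \<in> gen_algebra fs"
    and "\<forall>k<length Fs. g k \<noteq> 0 \<longrightarrow> degree (g k) + degree (Fs ! k) \<le> \<delta>"
    and "(\<Sum>k<length Fs. g k * Fs ! k) \<noteq> 0"
  shows "degree (\<Sum>k<length Fs. g k * Fs ! k) \<in> covered_degs (gen_algebra fs) Fs"
  using assms(4-)
proof (induction "(\<delta>, card (top_terms Fs g \<delta>))" arbitrary: g \<delta>
    rule: wf_induct_rule[OF wf_lex_prod[OF wf_less_than wf_less_than]])
  case (1 g \<delta>)
  consider "top_terms Fs g \<delta> = {}" | i where "top_terms Fs g \<delta> = {i}"
    | i j where "i \<in> top_terms Fs g \<delta>" "j \<in> top_terms Fs g \<delta>" "i \<noteq> j"
    by blast
  then show ?case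
  proof cases
    case 1
    have less: "\<forall>k<length Fs. g k \<noteq> 0 \<longrightarrow> degree (g k) + degree (Fs ! k) < \<delta>"
      using "1.prems"(2) 1 by (auto simp: top_terms_def order_less_le)
    \<comment> \<open>A nonzero coefficient under the strict bound forces
      \<open>\<delta> > 0\<close>, so the truncated predecessor \<open>\<delta> - 1\<close> is
      really smaller.\<close>
    moreover obtain k where "k < length Fs" "g k \<noteq> 0"
      using "1.prems"(3) by (metis (no_types, lifting) lessThan_iff mult_zero_left sum.neutral)
    ultimately have "\<delta> - 1 < \<delta>"
      by fastforce
    with less show ?thesis
      by (intro "1.hyps"[of "\<delta> - 1"] "1.prems") fastforce+
  next
    case 2
    then show ?thesis
      using degree_in_covered_degs_if_single_top_term assms(2) "1.prems" by blast
  next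
    case 3
    obtain g' where g': "\<forall>k<length Fs. g' k \<in> gen_algebra fs"
      "\<forall>k<length Fs. g' k \<noteq> 0 \<longrightarrow> degree (g' k) + degree (Fs ! k) \<le> \<delta>"
      and eq: "(\<Sum>k<length Fs. g' k * Fs ! k) = (\<Sum>k<length Fs. g k * Fs ! k)"
      and "top_terms Fs g' \<delta> \<subset> top_terms Fs g \<delta>"
      using cancel_top_term[OF assms(1-3) "1.prems"(1,2) 3] by blast
    then have "card (top_terms Fs g' \<delta>) < card (top_terms Fs g \<delta>)"
      by (intro psubset_card_mono finite_top_terms)
    then show ?thesis
      using "1.hyps"[of \<delta> g'] g' "1.prems"(3) by (simp add: eq)
  qed
qed

section \<open>The two implications of the equivalence\<close>

theorem theorem5p4:
  fixes fs Fs :: "'a::field poly list"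
    and A :: "'a poly set"
    and Rem :: "'a poly \<Rightarrow> 'a poly"
  assumes A_def: "A = gen_algebra fs"
    and nonzero: "\<forall>f\<in>set fs \<union> set Fs. f \<noteq> 0"
    and finite_length: "finite_length (algebra_ring A) (quotient_module poly_module A)"
    and reduced: "reduced_basis fs A"
    and monic: "\<forall>F\<in>set Fs. lead_coeff F = 1"
    and Rem: "remainder_choice A Fs Rem"
  shows "module_basis A Fs \<longleftrightarrow> (\<forall>F\<in>MinSP fs Fs. Rem F = 0)"
proof
  have A: "K_subalgebra A"
    unfolding A_def by (rule K_subalgebra_gen_algebra)
  assume basis: "module_basis A Fs"
  show "\<forall>F\<in>MinSP fs Fs. Rem F = 0"
  proof (intro ballI, rule ccontr)
    fix F assume F: "F \<in> MinSP fs Fs" and "Rem F \<noteq> 0"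
    \<comment> \<open>Since \<open>Rem 0 = 0\<close>, the assumption \<open>Rem F \<noteq> 0\<close>
      gives \<open>F \<noteq> 0\<close>.\<close>
    then have R: "is_remainder A Fs F (Rem F)"
      using Rem unfolding remainder_choice_def by metis
    then have "degree (Rem F) \<notin> covered_degs A Fs"
      using \<open>Rem F \<noteq> 0\<close> unfolding is_remainder_def by blast
    moreover have "F \<in> gen_module A Fs"
      using F MinSP_subset_gen_module A_def by blast
    then have "degree (Rem F) \<in> degs (gen_module A Fs)"
      using is_remainder_in_gen_module[OF A R] \<open>Rem F \<noteq> 0\<close> unfolding degs_def by blast
    ultimately show False
      using basis unfolding module_basis_def by blast
  qed
next
  assume "\<forall>F\<in>MinSP fs Fs. Rem F = 0"
  then have rem: "\<forall>F\<in>MinSP fs Fs. F \<noteq> 0 \<longrightarrow> is_remainder A Fs F 0"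
    using Rem unfolding remainder_choice_def by metis
  have "degs (gen_module A Fs) \<subseteq> covered_degs A Fs"
  proof
    fix n assume "n \<in> degs (gen_module A Fs)"
    then obtain g where g: "\<forall>k<length Fs. g k \<in> A"
      and H: "(\<Sum>k<length Fs. g k * Fs ! k) \<noteq> 0" "n = degree (\<Sum>k<length Fs. g k * Fs ! k)"
      unfolding degs_def gen_module_def by blast
    \<comment> \<open>Any common bound can start the descent; the sum of all degrees is one, and
      unlike a maximum it makes sense for an empty family.\<close>
    define \<delta> where "\<delta> = (\<Sum>k<length Fs. degree (g k) + degree (Fs ! k))"
    have "degree (g k) + degree (Fs ! k) \<le> \<delta>" if "k < length Fs" for k
      unfolding \<delta>_def using that
      by (intro member_le_sum[of k "{..<length Fs}" "\<lambda>k. degree (g k) + degree (Fs ! k)"]) auto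
    then show "n \<in> covered_degs A Fs"
      using degree_in_covered_degs[of fs Fs g \<delta>] reduced monic rem g H unfolding A_def by blast
  qed
  moreover have "covered_degs A Fs \<subseteq> degs (gen_module A Fs)"
    using covered_degs_subset_degs_gen_module K_subalgebra_gen_algebra nonzero
    unfolding A_def by blast
  ultimately show "module_basis A Fs"
    unfolding module_basis_def by blast
qed

end
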